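(* Let $\gamma,\delta>0$ with $\gamma\le\beta$ and let the Standing Assumption (stated in the context) be satisfied. Let $(\mathbf{x}^k,\mathbf{z}^k,\mathbf{s}^k)_{k\ge0}$ be generated by the PD3O iteration (defined in the context) from an arbitrary starting point $(\mathbf{z}^0,\mathbf{s}^0)\in\mathcal{X}\times\mathcal{S}$. Define $$\bar{\mathbf{x}}^k=\frac{1}{k+1}\sum_{i=0}^k\mathbf{x}^i,\qquad \bar{\mathbf{s}}^{k+1}=\frac{1}{k+1}\sum_{i=0}^k\mathbf{s}^{i+1}.$$ Then for every $k\ge0$, every $(\mathbf{x},\mathbf{s})\in\mathcal{X}\times\mathcal{S}$, and $\mathbf{z}=\mathbf{x}-\gamma\nabla f(\mathbf{x})-\gamma\mathbf{A}^\top\mathbf{s}$, $$\mathcal{L}(\bar{\mathbf{x}}^k,\mathbf{s})-\mathcal{L}(\mathbf{x},\bar{\mathbf{s}}^{k+1})\le\frac{1}{2(k+1)\gamma}\|(\mathbf{z},\mathbf{s})-(\mathbf{z}^0,\mathbf{s}^0)\|_{\mathbf{I},\mathbf{M}}^2,$$ where $\mathcal{L}(\mathbf{x},\mathbf{s})=f(\mathbf{x})+g(\mathbf{x})+\langle\mathbf{A}\mathbf{x},\mathbf{s}\rangle-h^*(\mathbf{s})-l^*(\mathbf{s})$.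
   Context: $\mathcal{X}$ and $\mathcal{S}$ are real Hilbert spaces, $\mathbf{A}:\mathcal{X}\to\mathcal{S}$ is a bounded linear operator with adjoint $\mathbf{A}^\top$, $\mathbf{I}$ is the identity operator, and $\gamma,\delta>0$ are stepsizes. $f:\mathcal{X}\to\mathbb{R}$, $g:\mathcal{X}\to(-\infty,+\infty]$, $h,l:\mathcal{S}\to(-\infty,+\infty]$ are proper lower semi-continuous convex functions; $h^*,l^*$ denote convex conjugates; $f$ and $l^*:\mathcal{S}\to\mathbb{R}$ are differentiable with Lipschitz continuous gradients. For $\lambda>0$ and a proper lower semi-continuous convex function $\phi$, $\mathbf{prox}_{\lambda\phi}(\tilde{\mathbf{x}})=\arg\min_{\mathbf{x}}\lambda\phi(\mathbf{x})+\frac12\|\mathbf{x}-\tilde{\mathbf{x}}\|^2$. The PD3O iteration is, for $k\ge0$, $$\mathbf{x}^k=\mathbf{prox}_{\gamma g}(\mathbf{z}^k),$$ $$\mathbf{s}^{k+1}=\mathbf{prox}_{\delta h^*}\big((\mathbf{I}-\gamma\delta\mathbf{A}\mathbf{A}^\top)\mathbf{s}^k-\delta\nabla l^*(\mathbf{s}^k)+\delta\mathbf{A}(2\mathbf{x}^k-\mathbf{z}^k-\gamma\nabla f(\mathbf{x}^k))\big),$$ $$\mathbf{z}^{k+1}=\mathbf{x}^k-\gamma\nabla f(\mathbf{x}^k)-\gamma\mathbf{A}^\top\mathbf{s}^{k+1}.$$ Let $\mathbf{M}=\frac{\gamma}{\delta}(\mathbf{I}-\gamma\delta\mathbf{A}\mathbf{A}^\top)$,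 $\langle\mathbf{s}_1,\mathbf{s}_2\rangle_{\mathbf{M}}=\langle\mathbf{s}_1,\mathbf{M}\mathbf{s}_2\rangle$, $\|\mathbf{s}\|_{\mathbf{M}}=\sqrt{\langle\mathbf{s},\mathbf{s}\rangle_{\mathbf{M}}}$ and $\|(\mathbf{z},\mathbf{s})\|_{\mathbf{I},\mathbf{M}}=\sqrt{\|\mathbf{z}\|^2+\|\mathbf{s}\|_{\mathbf{M}}^2}$ (when $\mathbf{M}$ is positive semidefinite, i.e. $\gamma\delta\|\mathbf{A}\mathbf{A}^\top\|\le1$). "Positive definite" means $\gamma\delta\|\mathbf{A}\mathbf{A}^\top\|<1$, so that $\mathbf{M}$ has a bounded inverse; then $\|\mathbf{s}\|_{\mathbf{M}^{-1}}=\sqrt{\langle\mathbf{s},\mathbf{M}^{-1}\mathbf{s}\rangle}$. Standing Assumption: there is $\beta>0$ such that for all $\mathbf{x}_1,\mathbf{x}_2\in\mathcal{X}$ and $\mathbf{s}_1,\mathbf{s}_2\in\mathcal{S}$, $$\langle\mathbf{x}_1-\mathbf{x}_2,\nabla f(\mathbf{x}_1)-\nabla f(\mathbf{x}_2)\rangle\ge\beta\|\nabla f(\mathbf{x}_1)-\nabla f(\mathbf{x}_2)\|^2,$$ $$\langle\mathbf{s}_1-\mathbf{s}_2,\nabla l^*(\mathbf{s}_1)-\nabla l^*(\mathbf{s}_2)\rangle\ge\beta\|\nabla l^*(\mathbf{s}_1)-\nabla l^*(\mathbf{s}_2)\|_{\mathbf{M}^{-1}}^2.$$ $\mathbf{M}$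 is assumed positive definite if $\nabla l^*$ is not constant. If $\nabla l^*$ is constant, the second inequality is regarded as satisfied for any $\beta>0$ and $\mathbf{M}$ is only assumed positive semidefinite. The difference $\mathcal{L}(\bar{\mathbf{x}}^k,\mathbf{s})-\mathcal{L}(\mathbf{x},\bar{\mathbf{s}}^{k+1})$ is taken in the extended reals; it equals $-\infty$ if $g(\mathbf{x})=+\infty$ or $h^*(\mathbf{s})=+\infty$. *)

theory Defs
  imports "HOL-Analysis.Analysis"
begin

text \<open>
  Real Hilbert spaces are types of sort \<open>{real_inner, complete_space}\<close>; functions into
  \<open>(-\<infinity>, \<infinity>]\<close> are \<open>ereal\<close>-valued, the value \<open>-\<infinity>\<close> being excluded by properness.
\<close>

definition proper_fun :: "('a \<Rightarrow> ereal) \<Rightarrow> bool" where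
  "proper_fun \<phi> \<longleftrightarrow> (\<forall>x. \<phi> x \<noteq> -\<infinity>) \<and> (\<exists>x. \<phi> x \<noteq> \<infinity>)"

definition lsc_fun :: "('a::topological_space \<Rightarrow> ereal) \<Rightarrow> bool" where
  "lsc_fun \<phi> \<longleftrightarrow> (\<forall>x. \<phi> x \<le> Liminf (at x) \<phi>)"

text \<open>
  In \<open>ereal\<close> we have \<open>0 * \<infinity> = 0\<close>, so the cases \<open>u = 0\<close> and \<open>v = 0\<close> are harmless.
\<close>

definition convex_fun :: "('a::real_vector \<Rightarrow> ereal) \<Rightarrow> bool" where
  "convex_fun \<phi> \<longleftrightarrow>
     (\<forall>x y. \<forall>u\<ge>0. \<forall>v\<ge>0. u + v = 1 \<longrightarrow>
        \<phi> (u *\<^sub>R x + v *\<^sub>R y) \<le> ereal u * \<phi> x + ereal v * \<phi> y)"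

definition proper_lsc_convex :: "('a::real_normed_vector \<Rightarrow> ereal) \<Rightarrow> bool" where
  "proper_lsc_convex \<phi> \<longleftrightarrow> proper_fun \<phi> \<and> lsc_fun \<phi> \<and> convex_fun \<phi>"

definition conjugate :: "('a::real_inner \<Rightarrow> ereal) \<Rightarrow> 'a \<Rightarrow> ereal" where
  "conjugate \<phi> s = (SUP x. ereal (x \<bullet> s) - \<phi> x)"

definition prox :: "real \<Rightarrow> ('a::real_inner \<Rightarrow> ereal) \<Rightarrow> 'a \<Rightarrow> 'a" where
  "prox t \<phi> w =
     arg_min (\<lambda>x. ereal t * \<phi> x + ereal (1/2 * (norm (x - w))\<^sup>2)) (\<lambda>_. True)"

definition M_op ::
    "real \<Rightarrow> real \<Rightarrow> ('a::real_inner \<Rightarrow> 'b::real_inner) \<Rightarrow> 'b \<Rightarrow> 'b" where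
  "M_op \<gamma> \<delta> A s = (\<gamma> / \<delta>) *\<^sub>R (s - (\<gamma> * \<delta>) *\<^sub>R A (adjoint A s))"

definition op_norm :: "('b::real_inner \<Rightarrow> 'b) \<Rightarrow> 'b \<Rightarrow> real" where
  "op_norm Q s = sqrt (s \<bullet> Q s)"

definition pair_norm :: "('b \<Rightarrow> 'b) \<Rightarrow> 'a::real_inner \<times> 'b::real_inner \<Rightarrow> real" where
  "pair_norm Q p = sqrt ((norm (fst p))\<^sup>2 + (op_norm Q (snd p))\<^sup>2)"

text \<open>
  \<open>gf\<close> and \<open>gl\<close> are the gradients of \<open>f\<close> and of the conjugate \<open>l\<^sup>*\<close>.
  If \<open>gl\<close> is constant, the operator need not be invertible and no inequality is required;
  otherwise \<open>M_op \<gamma> \<delta> A\<close> is a bijection, so that \<open>inv\<close> is its two-sided inverse.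
\<close>

definition standing_assumption ::
    "real \<Rightarrow> real \<Rightarrow> real \<Rightarrow> ('a::real_inner \<Rightarrow> 'b::real_inner)
       \<Rightarrow> ('a \<Rightarrow> 'a) \<Rightarrow> ('b \<Rightarrow> 'b) \<Rightarrow> bool" where
  "standing_assumption \<beta> \<gamma> \<delta> A gf gl \<longleftrightarrow>
     \<beta> > 0 \<and>
     (\<forall>x1 x2. (x1 - x2) \<bullet> (gf x1 - gf x2) \<ge> \<beta> * (norm (gf x1 - gf x2))\<^sup>2) \<and>
     (if \<exists>c. \<forall>s. gl s = c
      then \<gamma> * \<delta> * onorm (A \<circ> adjoint A) \<le> 1
      else \<gamma> * \<delta> * onorm (A \<circ> adjoint A) < 1 \<and>
           (\<forall>s1 s2. (s1 - s2) \<bullet> (gl s1 - gl s2)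
              \<ge> \<beta> * (op_norm (inv (M_op \<gamma> \<delta> A)) (gl s1 - gl s2))\<^sup>2))"

text \<open>The argument \<open>hc\<close> stands for the conjugate \<open>h\<^sup>*\<close>.\<close>

definition pd3o ::
    "real \<Rightarrow> real \<Rightarrow> ('a::real_inner \<Rightarrow> 'b::real_inner) \<Rightarrow> ('a \<Rightarrow> 'a) \<Rightarrow> ('a \<Rightarrow> ereal)
       \<Rightarrow> ('b \<Rightarrow> ereal) \<Rightarrow> ('b \<Rightarrow> 'b)
       \<Rightarrow> (nat \<Rightarrow> 'a) \<Rightarrow> (nat \<Rightarrow> 'a) \<Rightarrow> (nat \<Rightarrow> 'b) \<Rightarrow> bool" where
  "pd3o \<gamma> \<delta> A gf g hc gl x z s \<longleftrightarrow>
     (\<forall>k. x k = prox \<gamma> g (z k) \<and>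
          s (Suc k) = prox \<delta> hc
            ((s k - (\<gamma> * \<delta>) *\<^sub>R A (adjoint A (s k))) - \<delta> *\<^sub>R gl (s k)
              + \<delta> *\<^sub>R A (2 *\<^sub>R x k - z k - \<gamma> *\<^sub>R gf (x k))) \<and>
          z (Suc k) = x k - \<gamma> *\<^sub>R gf (x k) - \<gamma> *\<^sub>R adjoint A (s (Suc k)))"

text \<open>
  For \<open>g x = \<infinity>\<close> and \<open>hc s = \<infinity>\<close> the value is the \<open>ereal\<close> default \<open>\<infinity> - \<infinity> = \<infinity>\<close>.
  This does not affect differences \<open>lagrangian \<dots> x' s - lagrangian \<dots> x s'\<close> with \<open>g x'\<close> and
  \<open>hc s'\<close> finite: these equal \<open>-\<infinity>\<close> as soon as \<open>g x = \<infinity>\<close> or \<open>hc s = \<infinity>\<close>.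
\<close>

definition lagrangian ::
    "('a::real_inner \<Rightarrow> 'b::real_inner) \<Rightarrow> ('a \<Rightarrow> real) \<Rightarrow> ('a \<Rightarrow> ereal)
       \<Rightarrow> ('b \<Rightarrow> ereal) \<Rightarrow> ('b \<Rightarrow> ereal) \<Rightarrow> 'a \<Rightarrow> 'b \<Rightarrow> ereal" where
  "lagrangian A f g hc lc x s =
     ereal (f x) + g x + ereal (A x \<bullet> s) - hc s - lc s"

end

theory Submission
  imports Defs
begin

text \<open>
  The proof compares one iteration with an arbitrary pair \<open>(x, s)\<close> and then averages.  Put
  \<open>\<Delta>\<^sub>i = \<parallel>z - z\<^sub>i\<parallel>\<^sup>2 + \<parallel>s - s\<^sub>i\<parallel>\<^sub>M\<^sup>2\<close>, where \<open>z\<close> is formed from \<open>(x, s)\<close> in the same way as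
  \<open>z\<^sub>i\<^sub>+\<^sub>1\<close> is formed from \<open>(x\<^sub>i, s\<^sub>i\<^sub>+\<^sub>1)\<close>.  The heart of the matter is the inequality
  \<open>\<L>(x\<^sub>i, s) - \<L>(x, s\<^sub>i\<^sub>+\<^sub>1) \<le> (\<Delta>\<^sub>i - \<Delta>\<^sub>i\<^sub>+\<^sub>1) / (2 \<gamma>)\<close>, lemma \<open>pd3o_step_gap\<close>.  Summing over
  \<open>i = 0, \<dots>, k\<close> telescopes the right-hand side, \<open>\<Delta>\<^sub>k\<^sub>+\<^sub>1\<close> is nonnegative because \<open>M\<close> is
  positive semidefinite, and Jensen's inequality bounds the left-hand side from below by \<open>k + 1\<close>
  times the gap at the averages, since \<open>\<L>\<close> is convex in \<open>x\<close> and concave in \<open>s\<close>.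

  For one iteration, the two prox steps provide subgradients of \<open>g\<close> and \<open>h\<^sup>*\<close>
  (\<open>prox_variational_inequality\<close>).  Cocoercivity provides the rest: for \<open>f\<close> it sharpens the
  gradient inequality by \<open>\<beta> / 2\<close> times the squared distance of the gradients
  (\<open>cocoercive_gradient_lower_bound\<close>), and for \<open>l\<^sup>*\<close> it bounds the
  error of linearisation by \<open>\<parallel>\<cdot>\<parallel>\<^sub>M\<^sup>2 / (2 \<beta>)\<close> (\<open>gradient_quadratic_upper_bound\<close> and
  \<open>inner_gradient_increment_le\<close>).  When everything is added up and multiplied by
  \<open>\<gamma>\<close>, what remains apart from the
  telescoping squares is \<open>\<gamma> \<langle>z\<^sub>i - z\<^sub>i\<^sub>+\<^sub>1, u\<rangle> - \<parallel>z\<^sub>i - z\<^sub>i\<^sub>+\<^sub>1\<parallel>\<^sup>2 / 2 - \<gamma> \<beta> / 2 * \<parallel>u\<parallel>\<^sup>2\<close>, with \<open>u\<close> the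
  difference of the gradients of \<open>f\<close>, together with
  \<open>\<parallel>s\<^sub>i\<^sub>+\<^sub>1 - s\<^sub>i\<parallel>\<^sub>M\<^sup>2 * (\<gamma> / \<beta> - 1) / 2\<close>.  Both are at most \<open>0\<close> because \<open>\<gamma> \<le> \<beta>\<close>.

  The Hilbert space background rests on one existence result, that the objective in the definition
  of \<^const>\<open>prox\<close> attains its infimum (\<open>prox_objective_has_minimiser\<close>).  Applied to
  linear functionals it gives Riesz representation and hence the adjoint; applied to \<open>h\<close> it gives
  a subgradient, so that \<open>h\<^sup>*\<close> is proper.
\<close>

section \<open>Lower semicontinuous convex functions with extended real values\<close>

lemma lsc_fun_eventually:
  fixes \<phi> :: "'a::topological_space \<Rightarrow> ereal"
  assumes "lsc_fun \<phi>" "c < \<phi> x"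
  shows "eventually (\<lambda>y. c < \<phi> y) (nhds x)"
proof -
  have "\<phi> x \<le> Liminf (at x) \<phi>" using assms(1) by (simp add: lsc_fun_def)
  then have "eventually (\<lambda>y. c < \<phi> y) (at x)"
    using assms(2) by (auto simp: le_Liminf_iff)
  then show ?thesis using assms(2) by (simp add: eventually_nhds_conv_at)
qed

lemma lsc_funI:
  fixes \<phi> :: "'a::topological_space \<Rightarrow> ereal"
  assumes "\<And>x c. c < \<phi> x \<Longrightarrow> eventually (\<lambda>y. c < \<phi> y) (nhds x)"
  shows "lsc_fun \<phi>"
  unfolding lsc_fun_def le_Liminf_iff
  using assms by (auto simp: eventually_nhds_conv_at)

lemma proper_fun_real:
  assumes "proper_fun \<phi>" "\<phi> x \<noteq> \<infinity>"
  shows "\<phi> x = ereal (real_of_ereal (\<phi> x))"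
  using assms by (cases "\<phi> x") (auto simp: proper_fun_def)

lemma convex_fun_convex_on_domain:
  assumes "proper_fun \<phi>" "convex_fun \<phi>"
  shows "convex_on {x. \<phi> x \<noteq> \<infinity>} (\<lambda>x. real_of_ereal (\<phi> x))"
proof -
  have *: "\<phi> (u *\<^sub>R x + v *\<^sub>R y) \<le> ereal (u * real_of_ereal (\<phi> x) + v * real_of_ereal (\<phi> y))"
    if "\<phi> x \<noteq> \<infinity>" "\<phi> y \<noteq> \<infinity>" "u \<ge> 0" "v \<ge> 0" "u + v = 1" for x y u v
  proof -
    have "\<phi> (u *\<^sub>R x + v *\<^sub>R y) \<le> ereal u * \<phi> x + ereal v * \<phi> y"
      using assms(2) that unfolding convex_fun_def by blast
    also have "\<dots> = ereal (u * real_of_ereal (\<phi> x) + v * real_of_ereal (\<phi> y))"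
      using assms(1) that by (cases "\<phi> x"; cases "\<phi> y") (auto simp: proper_fun_def)
    finally show ?thesis .
  qed
  have D: "convex {x. \<phi> x \<noteq> \<infinity>}"
    unfolding convex_def using * by fastforce
  show ?thesis
    unfolding convex_on_def
  proof (intro conjI D ballI allI impI)
    fix x y u v assume h: "x \<in> {x. \<phi> x \<noteq> \<infinity>}" "y \<in> {x. \<phi> x \<noteq> \<infinity>}"
      "(0::real) \<le> u" "(0::real) \<le> v" "u + v = 1"
    then have "\<phi> (u *\<^sub>R x + v *\<^sub>R y) \<noteq> \<infinity>" using D unfolding convex_def by blast
    then show "real_of_ereal (\<phi> (u *\<^sub>R x + v *\<^sub>R y))
        \<le> u * real_of_ereal (\<phi> x) + v * real_of_ereal (\<phi> y)"
      using *[of x y u v] h proper_fun_real[OF assms(1), of "u *\<^sub>R x + v *\<^sub>R y"]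
      by (cases "\<phi> (u *\<^sub>R x + v *\<^sub>R y)") auto
  qed
qed

lemma convex_on_combination:
  assumes "convex_on D r" "x \<in> D" "y \<in> D" "0 \<le> u" "0 \<le> v" "u + v = 1"
  shows "u *\<^sub>R x + v *\<^sub>R y \<in> D" "r (u *\<^sub>R x + v *\<^sub>R y) \<le> u * r x + v * r y"
  using assms unfolding convex_on_def convex_def by blast+

text \<open>
  A cheap substitute for an affine minorant, which would require a separation theorem.
  Near a point \<open>x0\<close> of the domain the function exceeds \<open>\<phi> x0 - 1\<close> by lower
  semicontinuity.  If \<open>\<phi>\<close> were too small at a distant point \<open>x\<close>, convexity on the segment
  from \<open>x0\<close> to \<open>x\<close> would push its value at distance \<open>d\<close> from \<open>x0\<close> below that bound.  A linear lower bound of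
  this kind is dominated by the quadratic term in the definition of \<^const>\<open>prox\<close>.
\<close>

lemma proper_lsc_convex_minorant:
  fixes \<phi> :: "'a::real_normed_vector \<Rightarrow> ereal"
  assumes "proper_lsc_convex \<phi>"
  obtains x0 a b where "b \<ge> 0"
    "\<And>x. \<phi> x \<noteq> \<infinity> \<Longrightarrow> a - b * norm (x - x0) \<le> real_of_ereal (\<phi> x)"
proof -
  define r where "r = (\<lambda>x. real_of_ereal (\<phi> x))"
  have P: "proper_fun \<phi>" and lsc: "lsc_fun \<phi>" and C: "convex_fun \<phi>"
    using assms by (auto simp: proper_lsc_convex_def)
  obtain x0 where x0: "\<phi> x0 \<noteq> \<infinity>" using P by (auto simp: proper_fun_def)
  have r: "\<phi> x = ereal (r x)" if "\<phi> x \<noteq> \<infinity>" for x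
    using proper_fun_real[OF P that] by (simp add: r_def)
  have conv: "convex_on {x. \<phi> x \<noteq> \<infinity>} r"
    using convex_fun_convex_on_domain[OF P C] by (simp add: r_def)
  have "ereal (r x0 - 1) < \<phi> x0" using r[OF x0] by simp
  from lsc_fun_eventually[OF lsc this] obtain e where e: "e > 0"
    "\<And>y. dist y x0 < e \<Longrightarrow> ereal (r x0 - 1) < \<phi> y"
    by (auto simp: eventually_nhds_metric)
  define d where "d = e / 2"
  have d: "d > 0" "d < e" using e by (auto simp: d_def)
  have "r x0 - 1 - (1 / d) * norm (x - x0) \<le> r x" if x: "\<phi> x \<noteq> \<infinity>" for x
  proof (cases "norm (x - x0) < e")
    case True
    then have "r x0 - 1 < r x" using e(2)[of x] r[OF x] by (simp add: dist_norm)
    moreover have "(1 / d) * norm (x - x0) \<ge> 0" using d by simp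
    ultimately show ?thesis by linarith
  next
    case False
    define n where "n = norm (x - x0)"
    define \<tau> where "\<tau> = d / n"
    have n: "n \<ge> e" "n > 0" using False e by (auto simp: n_def)
    have \<tau>: "0 < \<tau>" "\<tau> < 1" "\<tau> * n = d" using n d by (auto simp: \<tau>_def)
    let ?y = "(1 - \<tau>) *\<^sub>R x0 + \<tau> *\<^sub>R x"
    have yx: "?y - x0 = \<tau> *\<^sub>R (x - x0)" by (simp add: algebra_simps)
    (* ?y is the point of the segment from x0 to x at distance d from x0. *)
    have "norm (?y - x0) = d"
      unfolding yx using \<tau> by (simp add: n_def)
    then have lo: "ereal (r x0 - 1) < \<phi> ?y" using e(2) d by (simp add: dist_norm)
    have up: "r ?y \<le> (1 - \<tau>) * r x0 + \<tau> * r x" "\<phi> ?y \<noteq> \<infinity>"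
      using conv x0 x \<tau> unfolding convex_on_def convex_def by auto
    have "r x0 - 1 < r ?y" using lo r[OF up(2)] by simp
    then have "r x0 - 1 < (1 - \<tau>) * r x0 + \<tau> * r x" using up by linarith
    then have "\<tau> * (r x0 - r x) < 1" by (simp add: algebra_simps)
    then have "r x0 - r x < 1 / \<tau>" using \<tau> by (simp add: field_simps)
    also have "1 / \<tau> = (1 / d) * n" by (simp add: \<tau>_def)
    finally show ?thesis by (simp add: n_def)
  qed
  then show ?thesis using that[of "1 / d" "r x0 - 1" x0] d by (simp add: r_def)
qed

section \<open>Proximal points and their variational inequality\<close>

lemma midpoint_norm_identity:
  fixes a b w :: "'a::real_inner"
  shows "(norm ((1/2) *\<^sub>R a + (1/2) *\<^sub>R b - w))\<^sup>2
    = (1/2) * (norm (a - w))\<^sup>2 + (1/2) * (norm (b - w))\<^sup>2 - (1/4) * (norm (a - b))\<^sup>2"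
proof -
  have "(1/2) *\<^sub>R a + (1/2) *\<^sub>R b - w = (1/2) *\<^sub>R ((a - w) + (b - w))"
    by (simp add: scaleR_add_right scaleR_diff_right algebra_simps flip: scaleR_2)
  moreover have "a - b = (a - w) - (b - w)" by simp
  ultimately show ?thesis
    unfolding power2_norm_eq_inner
    by (simp only: inner_add_left inner_add_right inner_diff_left[of "a - w"]
        inner_diff_right[of _ "a - w" "b - w"] inner_scaleR_left inner_scaleR_right
        inner_commute[of "b - w" "a - w"]) (simp add: field_simps)
qed

text \<open>
  The objective \<open>F\<close> is bounded below by the linear minorant, and the parallelogram identity
  makes it strongly convex: two points at which \<open>F\<close> is close to its infimum are close to each
  other, since otherwise their midpoint would lie below the infimum.  So a minimising sequence
  is Cauchy, and lower semicontinuity passes the infimum on to its limit.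
\<close>

lemma prox_objective_has_minimiser:
  fixes \<phi> :: "'a::{real_inner,complete_space} \<Rightarrow> ereal"
  assumes "proper_lsc_convex \<phi>" "t > 0"
  obtains p where "\<phi> p \<noteq> \<infinity>"
    "\<And>y. \<phi> y \<noteq> \<infinity> \<Longrightarrow> t * real_of_ereal (\<phi> p) + 1/2 * (norm (p - w))\<^sup>2
        \<le> t * real_of_ereal (\<phi> y) + 1/2 * (norm (y - w))\<^sup>2"
proof -
  define r where "r = (\<lambda>x. real_of_ereal (\<phi> x))"
  define D where "D = {x. \<phi> x \<noteq> \<infinity>}"
  have P: "proper_fun \<phi>" and lsc: "lsc_fun \<phi>" and C: "convex_fun \<phi>"
    using assms by (auto simp: proper_lsc_convex_def)
  have r: "\<phi> x = ereal (r x)" if "x \<in> D" for x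
    using proper_fun_real[OF P, of x] that by (simp add: r_def D_def)
  have conv: "convex_on D r"
    using convex_fun_convex_on_domain[OF P C] by (simp add: r_def D_def)
  have ne: "D \<noteq> {}" using P by (auto simp: proper_fun_def D_def)
  define F where "F = (\<lambda>x. t * r x + 1/2 * (norm (x - w))\<^sup>2)"
  obtain x0 a b where ab: "b \<ge> 0" "\<And>x. x \<in> D \<Longrightarrow> a - b * norm (x - x0) \<le> r x"
    by (rule proper_lsc_convex_minorant[OF assms(1)]) (auto simp: r_def D_def)
  have bdd: "bdd_below (F ` D)"
  proof (rule bdd_belowI2)
    fix x assume "x \<in> D"
    then have "t * (a - b * norm (x - x0)) \<le> t * r x" using ab assms(2) by simp
    moreover have "t * b * norm (x - x0) \<le> t * b * (norm (x - w) + norm (w - x0))"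
      using ab(1) assms(2) norm_triangle_ineq[of "x - w" "w - x0"]
      by (intro mult_left_mono) auto
    moreover have "0 \<le> (norm (x - w) - t * b)\<^sup>2" by simp
    (* The last inequality absorbs t * b * norm (x - w) into half the square of norm (x - w). *)
    ultimately show "t * a - t * b * norm (w - x0) - (t * b)\<^sup>2 / 2 \<le> F x"
      unfolding F_def by (simp add: power2_eq_square algebra_simps)
  qed
  define m where "m = Inf (F ` D)"
  have m_le: "m \<le> F x" if "x \<in> D" for x
    using bdd that by (auto simp: m_def intro: cInf_lower)
  have "\<exists>x\<in>D. F x < m + 1 / real (Suc n)" for n
    using cInf_lessD[of "F ` D" "m + 1 / real (Suc n)"] ne by (auto simp: m_def)
  then obtain X where X: "\<And>n. X n \<in> D" "\<And>n. F (X n) < m + 1 / real (Suc n)" by metis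
  have strong: "(norm (X i - X j))\<^sup>2 \<le> 4 * (1 / real (Suc i) + 1 / real (Suc j))" for i j
  proof -
    let ?y = "(1/2) *\<^sub>R X i + (1/2) *\<^sub>R X j"
    have y: "?y \<in> D" "r ?y \<le> (1/2) * r (X i) + (1/2) * r (X j)"
      by (rule convex_on_combination[OF conv X(1)[of i] X(1)[of j]]; simp)+
    have "t * r ?y \<le> t * ((1/2) * r (X i) + (1/2) * r (X j))" using y assms(2) by simp
    then have "F ?y \<le> (1/2) * F (X i) + (1/2) * F (X j) - (1/8) * (norm (X i - X j))\<^sup>2"
      unfolding F_def midpoint_norm_identity by (simp add: algebra_simps)
    then have "(norm (X i - X j))\<^sup>2 \<le> 4 * (F (X i) + F (X j)) - 8 * F ?y" by simp
    then show ?thesis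
      using m_le[OF y(1)] add_strict_mono[OF X(2)[of i] X(2)[of j]]
      unfolding distrib_left by linarith
  qed
  have "Cauchy X"
  proof (rule CauchyI)
    fix e :: real assume e: "e > 0"
    obtain N where N: "1 / real (Suc N) < e\<^sup>2 / 8"
      using nat_approx_posE[of "e\<^sup>2 / 8"] e by (auto simp: inverse_eq_divide)
    have "norm (X i - X j) < e" if "i \<ge> N" "j \<ge> N" for i j
    proof -
      have "1 / real (Suc i) \<le> 1 / real (Suc N)" "1 / real (Suc j) \<le> 1 / real (Suc N)"
        using that by (auto simp: frac_le)
      then have "(norm (X i - X j))\<^sup>2 < e\<^sup>2" using strong[of i j] N unfolding distrib_left by linarith
      then show ?thesis using e by (simp add: power_less_imp_less_base)
    qed
    then show "\<exists>M. \<forall>m\<ge>M. \<forall>n\<ge>M. norm (X m - X n) < e" by blast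
  qed
  then obtain p where p: "X \<longlonglongrightarrow> p" using Cauchy_convergent convergent_def by blast
  have below: "t * c + 1/2 * (norm (p - w))\<^sup>2 \<le> m" if c: "ereal c < \<phi> p" for c
  proof (rule tendsto_le[OF sequentially_bot])
    show "(\<lambda>n. m + 1 / real (Suc n)) \<longlonglongrightarrow> m"
      using LIMSEQ_inverse_real_of_nat_add[of m] by (simp add: inverse_eq_divide)
    show "(\<lambda>n. t * c + 1/2 * (norm (X n - w))\<^sup>2) \<longlonglongrightarrow> t * c + 1/2 * (norm (p - w))\<^sup>2"
      by (intro tendsto_intros p)
    have "eventually (\<lambda>n. ereal c < \<phi> (X n)) sequentially"
      using lsc_fun_eventually[OF lsc c] p by (rule eventually_compose_filterlim)
    then show "eventually (\<lambda>n. t * c + 1/2 * (norm (X n - w))\<^sup>2 \<le> m + 1 / real (Suc n)) sequentially"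
    proof eventually_elim
      case (elim n)
      then have "c < r (X n)" using r[OF X(1)[of n]] by simp
      then have "t * c \<le> t * r (X n)" using assms(2) by simp
      then show ?case using X(2)[of n] unfolding F_def by linarith
    qed
  qed
  have pD: "p \<in> D"
  proof (rule ccontr)
    assume "p \<notin> D"
    then have inf: "\<phi> p = \<infinity>" by (simp add: D_def)
    show False using below[of "(m + 1 - 1/2 * (norm (p - w))\<^sup>2) / t"] inf assms(2) by simp
  qed
  have "F p \<le> m"
  proof (rule field_le_epsilon)
    fix e :: real assume e: "e > 0"
    have "t * (r p - e / t) + 1/2 * (norm (p - w))\<^sup>2 \<le> m"
      using below[of "r p - e / t"] r[OF pD] e assms(2) by simp
    then show "F p \<le> m + e" using assms(2) by (simp add: F_def algebra_simps)
  qed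
  then show ?thesis using that[of p] pD m_le unfolding F_def r_def D_def by fastforce
qed

lemma nonneg_of_small_perturbations:
  fixes a b :: real
  assumes "\<And>t. 0 < t \<Longrightarrow> t < 1 \<Longrightarrow> 0 \<le> a + t * b"
  shows "0 \<le> a"
proof (rule tendsto_le[of "at_right (0::real)" "\<lambda>t. a + t * b" _ "\<lambda>_. 0"])
  show "((\<lambda>t. a + t * b) \<longlongrightarrow> a) (at_right 0)"
    by (rule tendsto_eq_intros refl | simp)+
  show "\<forall>\<^sub>F t in at_right 0. 0 \<le> a + t * b"
    using assms by (auto simp: eventually_at_right_field intro!: exI[of _ 1])
qed auto

lemma power2_norm_add_scaled:
  fixes a b :: "'a::real_inner"
  shows "(norm (a + u *\<^sub>R b))\<^sup>2 = (norm a)\<^sup>2 + 2 * u * (a \<bullet> b) + u\<^sup>2 * (norm b)\<^sup>2"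
  unfolding power2_norm_eq_inner
  by (simp add: inner_add_left inner_add_right inner_commute[of b a] power2_eq_square
      algebra_simps)

text \<open>
  The inequality says that \<open>(w - p) / t\<close> is a subgradient of \<open>\<phi>\<close> at the proximal point
  \<open>p\<close>.  It follows by comparing \<open>p\<close> with \<open>p + u (y - p)\<close>, dividing by \<open>u\<close> and letting
  \<open>u\<close> tend to \<open>0\<close>.
\<close>

lemma prox_variational_inequality:
  fixes \<phi> :: "'a::{real_inner,complete_space} \<Rightarrow> ereal"
  assumes "proper_lsc_convex \<phi>" "t > 0" "p = prox t \<phi> w"
  shows "\<phi> p \<noteq> \<infinity>"
    and "\<phi> y \<noteq> \<infinity> \<Longrightarrow> real_of_ereal (\<phi> p) + (w - p) \<bullet> (y - p) / t \<le> real_of_ereal (\<phi> y)"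
proof -
  define r where "r = (\<lambda>x. real_of_ereal (\<phi> x))"
  define D where "D = {x. \<phi> x \<noteq> \<infinity>}"
  have P: "proper_fun \<phi>" and C: "convex_fun \<phi>"
    using assms by (auto simp: proper_lsc_convex_def)
  have r: "\<phi> x = ereal (r x)" if "x \<in> D" for x
    using proper_fun_real[OF P, of x] that by (simp add: r_def D_def)
  have conv: "convex_on D r"
    using convex_fun_convex_on_domain[OF P C] by (simp add: r_def D_def)
  let ?F = "\<lambda>x. ereal t * \<phi> x + ereal (1/2 * (norm (x - w))\<^sup>2)"
  have FD: "?F x = ereal (t * r x + 1/2 * (norm (x - w))\<^sup>2)" if "x \<in> D" for x
    using r[OF that] by simp
  have Fout: "?F x = \<infinity>" if "x \<notin> D" for x
    using that assms(2) by (simp add: D_def)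
  obtain q where q: "q \<in> D" "\<And>y. y \<in> D \<Longrightarrow>
      t * r q + 1/2 * (norm (q - w))\<^sup>2 \<le> t * r y + 1/2 * (norm (y - w))\<^sup>2"
    by (rule prox_objective_has_minimiser[OF assms(1,2), of w]) (auto simp: D_def r_def)
  have "?F q \<le> ?F y" for y
  proof (cases "y \<in> D")
    case True
    then show ?thesis using q FD by simp
  next
    case False
    show ?thesis unfolding Fout[OF False] by simp
  qed
  then have "is_arg_min ?F (\<lambda>_. True) q"
    by (auto simp: is_arg_min_def not_less)
  then have "is_arg_min ?F (\<lambda>_. True) p"
    unfolding assms(3) prox_def arg_min_def by (rule someI)
  then have min: "?F p \<le> ?F y" for y by (auto simp: is_arg_min_def not_less)
  have pD: "p \<in> D" using min[of q] FD[OF q(1)] Fout[of p] by fastforce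
  then show "\<phi> p \<noteq> \<infinity>" by (simp add: D_def)
  show "real_of_ereal (\<phi> p) + (w - p) \<bullet> (y - p) / t \<le> real_of_ereal (\<phi> y)" if "\<phi> y \<noteq> \<infinity>"
  proof -
    have y: "y \<in> D" using that by (simp add: D_def)
    have "0 \<le> (t * (r y - r p) + (p - w) \<bullet> (y - p)) + u * ((norm (y - p))\<^sup>2 / 2)"
      if u: "0 < u" "u < 1" for u
    proof -
      let ?v = "(1 - u) *\<^sub>R p + u *\<^sub>R y"
      have v: "?v \<in> D" "r ?v \<le> (1 - u) * r p + u * r y"
        using conv pD y u unfolding convex_on_def convex_def by auto
      have vw: "?v - w = (p - w) + u *\<^sub>R (y - p)" by (simp add: algebra_simps)
      have nv: "(norm (?v - w))\<^sup>2
          = (norm (p - w))\<^sup>2 + 2 * u * ((p - w) \<bullet> (y - p)) + u\<^sup>2 * (norm (y - p))\<^sup>2"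
        unfolding vw by (rule power2_norm_add_scaled)
      have "t * r p + 1/2 * (norm (p - w))\<^sup>2 \<le> t * r ?v + 1/2 * (norm (?v - w))\<^sup>2"
        using min[of ?v] FD[OF pD] FD[OF v(1)] by simp
      moreover have "t * r ?v \<le> t * ((1 - u) * r p + u * r y)" using v assms(2) by simp
      ultimately have "0 \<le> u * ((t * (r y - r p) + (p - w) \<bullet> (y - p))
          + u * ((norm (y - p))\<^sup>2 / 2))"
        unfolding nv by (simp add: algebra_simps power2_eq_square)
      then show ?thesis using u by (simp add: zero_le_mult_iff)
    qed
    then have "0 \<le> t * (r y - r p) + (p - w) \<bullet> (y - p)" by (rule nonneg_of_small_perturbations)
    moreover have "(p - w) \<bullet> (y - p) = - ((w - p) \<bullet> (y - p))"
      by (metis inner_minus_left minus_diff_eq)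
    ultimately show ?thesis using assms(2) by (simp add: r_def field_simps)
  qed
qed

section \<open>Riesz representation and adjoints in Hilbert space\<close>

lemma convex_funI_ereal:
  assumes "convex_on UNIV f"
  shows "convex_fun (\<lambda>x. ereal (f x))"
  using assms by (auto simp: convex_fun_def convex_on_def)

lemma lsc_fun_continuous:
  fixes f :: "'a::t2_space \<Rightarrow> real"
  assumes "\<And>x. isCont f x"
  shows "lsc_fun (\<lambda>x. ereal (f x))"
proof (rule lsc_funI)
  fix x c assume "c < ereal (f x)"
  moreover have "((\<lambda>y. ereal (f y)) \<longlongrightarrow> ereal (f x)) (nhds x)"
    using assms[of x] by (intro tendsto_intros) (simp add: isCont_def tendsto_at_iff_tendsto_nhds)
  ultimately show "eventually (\<lambda>y. c < ereal (f y)) (nhds x)" by (rule order_tendstoD(1)[rotated])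
qed

text \<open>
  The representing vector is the minimiser of \<open>\<parallel>x\<parallel>\<^sup>2 / 2 - L x\<close>, that is, a proximal point
  of \<open>- L\<close>: for a linear function the variational inequality, applied to \<open>v\<close> and to
  \<open>- v\<close>, becomes an equation.
\<close>

lemma riesz_representation:
  fixes L :: "'a::{real_inner,complete_space} \<Rightarrow> real"
  assumes "bounded_linear L"
  obtains p where "\<And>y. L y = p \<bullet> y"
proof -
  interpret bounded_linear L by fact
  let ?\<phi> = "\<lambda>x. ereal (- L x)"
  have "convex_on UNIV (\<lambda>x. - L x)"
    by (auto simp: convex_on_def add scaleR)
  moreover have "lsc_fun ?\<phi>"
    by (rule lsc_fun_continuous) (intro continuous_intros isCont continuous_ident)
  ultimately have \<phi>: "proper_lsc_convex ?\<phi>"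
    by (auto simp: proper_lsc_convex_def proper_fun_def intro: convex_funI_ereal)
  define p where "p = prox 1 ?\<phi> 0"
  have le: "L v \<le> p \<bullet> v" for v
    using prox_variational_inequality(2)[OF \<phi>, of 1 p 0 "p + v"] by (simp add: p_def add)
  have "L v = p \<bullet> v" for v
    using le[of v] le[of "- v"] by (simp add: neg)
  then show ?thesis using that by blast
qed

text \<open>
  The constant \<^const>\<open>adjoint\<close> is a choice among all operators with this property, so the
  point is that there is one; Riesz representation provides it.
\<close>

lemma inner_adjoint:
  fixes A :: "'a::{real_inner,complete_space} \<Rightarrow> 'b::real_inner"
  assumes "bounded_linear A"
  shows "A x \<bullet> y = x \<bullet> adjoint A y"
proof -
  have "\<exists>v. \<forall>x. A x \<bullet> y = x \<bullet> v" for y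
  proof -
    have "bounded_linear (\<lambda>x. A x \<bullet> y)"
      by (rule bounded_linear_compose[OF bounded_linear_inner_left assms])
    then obtain p where "\<And>x. A x \<bullet> y = p \<bullet> x" by (rule riesz_representation) blast
    then show ?thesis by (auto simp: inner_commute)
  qed
  then have "\<exists>B. \<forall>x y. A x \<bullet> y = x \<bullet> B y" by metis
  then have "\<forall>x y. A x \<bullet> y = x \<bullet> adjoint A y" unfolding adjoint_def by (rule someI_ex)
  then show ?thesis by blast
qed

lemma bounded_linear_adjoint:
  fixes A :: "'a::{real_inner,complete_space} \<Rightarrow> 'b::real_inner"
  assumes "bounded_linear A"
  shows "bounded_linear (adjoint A)"
proof -
  note adj = inner_adjoint[OF assms, symmetric]
  show ?thesis
  proof (rule bounded_linear_intro)
    show "adjoint A (x + y) = adjoint A x + adjoint A y" for x y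
      by (rule vector_eq_rdot[THEN iffD1]) (auto simp: adj inner_add_right inner_commute)
    show "adjoint A (c *\<^sub>R x) = c *\<^sub>R adjoint A x" for c x
      by (rule vector_eq_rdot[THEN iffD1]) (auto simp: adj inner_commute)
    fix y
    have "norm (adjoint A y) * norm (adjoint A y) = A (adjoint A y) \<bullet> y"
      by (simp add: inner_adjoint[OF assms] power2_norm_eq_inner flip: power2_eq_square)
    also have "\<dots> \<le> norm (A (adjoint A y)) * norm y" by (rule norm_cauchy_schwarz)
    also have "\<dots> \<le> onorm A * norm (adjoint A y) * norm y"
      by (rule mult_right_mono[OF onorm[OF assms]]) simp
    finally show "norm (adjoint A y) \<le> norm y * onorm A"
      by (cases "adjoint A y = 0") (auto simp: onorm_pos_le assms mult.commute mult_ac)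
  qed
qed

section \<open>Convex conjugates\<close>

text \<open>
  As a supremum of continuous affine functions the conjugate is lower semicontinuous and convex.
  It is finite somewhere because \<open>h\<close> has a subgradient somewhere, namely \<open>- p\<close> at the proximal
  point \<open>p\<close> of the origin.
\<close>

lemma conjugate_proper_lsc_convex:
  fixes h :: "'a::{real_inner,complete_space} \<Rightarrow> ereal"
  assumes "proper_lsc_convex h"
  shows "proper_lsc_convex (conjugate h)"
proof -
  have P: "proper_fun h" using assms by (simp add: proper_lsc_convex_def)
  have term_le: "ereal (x \<bullet> s) - h x \<le> conjugate h s" for x s
    unfolding conjugate_def by (rule SUP_upper) simp
  have hr: "h x = ereal (real_of_ereal (h x))" if "h x \<noteq> \<infinity>" for x
    by (rule proper_fun_real[OF P that])
  have "lsc_fun (conjugate h)"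
  proof (rule lsc_funI)
    fix s c assume "c < conjugate h s"
    then obtain x where x: "c < ereal (x \<bullet> s) - h x" by (auto simp: conjugate_def less_SUP_iff)
    then have "h x \<noteq> \<infinity>" by auto
    define b where "b = real_of_ereal (h x)"
    have b: "h x = ereal b" using hr[OF \<open>h x \<noteq> \<infinity>\<close>] by (simp add: b_def)
    have "lsc_fun (\<lambda>s. ereal (x \<bullet> s - b))"
      by (rule lsc_fun_continuous) (intro continuous_intros)
    from lsc_fun_eventually[OF this, of c s] x b
    have "eventually (\<lambda>s. c < ereal (x \<bullet> s - b)) (nhds s)" by simp
    then show "eventually (\<lambda>s. c < conjugate h s) (nhds s)"
      by eventually_elim (use term_le[of x] b in \<open>auto intro: less_le_trans\<close>)
  qed
  moreover have "convex_fun (conjugate h)"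
    unfolding convex_fun_def
  proof (intro allI impI)
    fix s1 s2 and u v :: real assume uv: "0 \<le> u" "0 \<le> v" "u + v = 1"
    show "conjugate h (u *\<^sub>R s1 + v *\<^sub>R s2) \<le> ereal u * conjugate h s1 + ereal v * conjugate h s2"
      unfolding conjugate_def[of h "u *\<^sub>R s1 + v *\<^sub>R s2"]
    proof (rule SUP_least)
      fix x
      show "ereal (x \<bullet> (u *\<^sub>R s1 + v *\<^sub>R s2)) - h x
          \<le> ereal u * conjugate h s1 + ereal v * conjugate h s2"
      proof (cases "h x = \<infinity>")
        case False
        define b where "b = real_of_ereal (h x)"
        have b: "h x = ereal b" using hr[OF False] by (simp add: b_def)
        have "b = u * b + v * b" using uv by (metis distrib_right mult_1)
        then have "ereal (x \<bullet> (u *\<^sub>R s1 + v *\<^sub>R s2)) - h x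
            = ereal u * (ereal (x \<bullet> s1) - h x) + ereal v * (ereal (x \<bullet> s2) - h x)"
          by (simp add: b inner_add_right algebra_simps)
        also have "\<dots> \<le> ereal u * conjugate h s1 + ereal v * conjugate h s2"
          by (intro add_mono ereal_mult_left_mono term_le) (use uv in auto)
        finally show ?thesis .
      qed simp
    qed
  qed
  moreover have "proper_fun (conjugate h)"
    unfolding proper_fun_def
  proof
    obtain x where x: "h x \<noteq> \<infinity>" using P by (auto simp: proper_fun_def)
    show "\<forall>s. conjugate h s \<noteq> -\<infinity>"
    proof
      fix s
      show "conjugate h s \<noteq> -\<infinity>" using term_le[of x s] hr[OF x]
        by (cases "h x") auto
    qed
    define p where "p = prox 1 h 0"
    have p: "h p \<noteq> \<infinity>" "\<And>y. h y \<noteq> \<infinity> \<Longrightarrow> real_of_ereal (h p) + (- p) \<bullet> (y - p) \<le> real_of_ereal (h y)"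
      using prox_variational_inequality[OF assms, of 1 p 0] by (auto simp: p_def)
    have "conjugate h (- p) \<le> ereal ((- p) \<bullet> p - real_of_ereal (h p))"
      unfolding conjugate_def
    proof (rule SUP_least)
      fix y
      show "ereal (y \<bullet> - p) - h y \<le> ereal (- p \<bullet> p - real_of_ereal (h p))"
      proof (cases "h y = \<infinity>")
        case False
        have "ereal (y \<bullet> - p) - h y = ereal (y \<bullet> - p - real_of_ereal (h y))"
          by (subst hr[OF False]) simp
        then show ?thesis using p(2)[OF False]
          by (simp add: inner_diff_right inner_commute algebra_simps)
      qed simp
    qed
    then show "\<exists>s. conjugate h s \<noteq> \<infinity>" by (intro exI[of _ "- p"]) auto
  qed
  ultimately show ?thesis by (simp add: proper_lsc_convex_def)
qed

section \<open>Gradient inequalities\<close>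

lemma GDERIV_along_line:
  assumes "\<And>x. GDERIV f x :> gf x"
  shows "((\<lambda>t. f (x + t *\<^sub>R d)) has_real_derivative (gf (x + t *\<^sub>R d) \<bullet> d)) (at t)"
proof -
  have "(f has_derivative (\<lambda>h. h \<bullet> gf (x + t *\<^sub>R d))) (at (x + t *\<^sub>R d))"
    using assms by (simp add: gderiv_def)
  moreover have "((\<lambda>t. x + t *\<^sub>R d) has_derivative (\<lambda>h. h *\<^sub>R d)) (at t)"
    by (auto intro!: derivative_eq_intros)
  ultimately have "((\<lambda>t. f (x + t *\<^sub>R d)) has_derivative (\<lambda>h. (h *\<^sub>R d) \<bullet> gf (x + t *\<^sub>R d))) (at t)"
    by (rule has_derivative_compose[rotated])
  moreover have "(\<lambda>h. (h *\<^sub>R d) \<bullet> gf (x + t *\<^sub>R d)) = (*) (gf (x + t *\<^sub>R d) \<bullet> d)"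
    by (simp add: fun_eq_iff inner_commute)
  ultimately show ?thesis by (simp add: has_field_derivative_def)
qed

text \<open>
  The descent lemma, with a quadratic form in place of a Lipschitz constant times the squared norm:
  on the segment from \<open>x\<close> to \<open>y\<close> the difference of both sides has a derivative of constant
  sign.  The form \<open>q\<close> is left general because the gradient of \<open>l\<^sup>*\<close> is measured
  in the metric of the algorithm, and because \<open>q = 0\<close>, applied to \<open>- f\<close>, yields the
  gradient inequality of a convex function.
\<close>

lemma gradient_quadratic_upper_bound:
  fixes f :: "'a::real_inner \<Rightarrow> real"
  assumes grad: "\<And>x. GDERIV f x :> gf x"
    and bound: "\<And>a b. (a - b) \<bullet> (gf a - gf b) \<le> q (a - b)"
    and quad: "\<And>t v. q (t *\<^sub>R v) = t\<^sup>2 * q v"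
  shows "f y \<le> f x + gf x \<bullet> (y - x) + q (y - x) / 2"
proof -
  define d where "d = y - x"
  define \<psi> where "\<psi> = (\<lambda>t. f (x + t *\<^sub>R d) - t * (gf x \<bullet> d) - t\<^sup>2 / 2 * q d)"
  have "\<psi> 1 \<le> \<psi> 0"
  proof (rule DERIV_nonpos_imp_nonincreasing[of 0 1 \<psi>])
    fix t :: real assume t: "0 \<le> t" "t \<le> 1"
    have der: "(\<psi> has_real_derivative (gf (x + t *\<^sub>R d) \<bullet> d - gf x \<bullet> d - t * q d)) (at t)"
      unfolding \<psi>_def by (auto intro!: derivative_eq_intros GDERIV_along_line grad)
    have "gf (x + t *\<^sub>R d) \<bullet> d - gf x \<bullet> d - t * q d \<le> 0"
    proof (cases "t = 0")
      case False
      have "t * (d \<bullet> (gf (x + t *\<^sub>R d) - gf x)) \<le> t * (t * q d)"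
        using bound[of "x + t *\<^sub>R d" x] by (simp add: quad power2_eq_square mult.assoc)
      then have "d \<bullet> (gf (x + t *\<^sub>R d) - gf x) \<le> t * q d"
        using t False by simp
      then show ?thesis by (simp add: inner_diff_right inner_commute)
    qed simp
    with der show "\<exists>D. (\<psi> has_real_derivative D) (at t) \<and> D \<le> 0" by blast
  qed simp
  then show ?thesis by (simp add: \<psi>_def d_def)
qed

lemma monotone_gradient_lower_bound:
  fixes f :: "'a::real_inner \<Rightarrow> real"
  assumes grad: "\<And>x. GDERIV f x :> gf x"
    and mono: "\<And>a b. 0 \<le> (a - b) \<bullet> (gf a - gf b)"
  shows "f x + gf x \<bullet> (y - x) \<le> f y"
proof -
  have "GDERIV (\<lambda>x. - f x) x :> - gf x" for x by (rule GDERIV_minus[OF grad])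
  moreover have "(a - b) \<bullet> (- gf a - - gf b) \<le> 0" for a b
    using mono[of a b] by (simp add: inner_diff_right)
  ultimately have "- f y \<le> - f x + - gf x \<bullet> (y - x) + 0 / 2"
    using gradient_quadratic_upper_bound[of "\<lambda>x. - f x" "\<lambda>x. - gf x" "\<lambda>_. 0" y x] by simp
  then show ?thesis by simp
qed

text \<open>
  An estimate from the proof of the Baillon--Haddad theorem.  The tangent at \<open>x\<close> and the
  quadratic upper bound at \<open>y\<close> are compared at the point \<open>w = y - \<beta> (gf y - gf x)\<close>, which
  is where their difference is extremal; this leaves a gain of
  \<open>\<beta> / 2\<close> times the squared distance of the gradients over plain convexity.
\<close>

lemma cocoercive_gradient_lower_bound:
  fixes f :: "'a::real_inner \<Rightarrow> real"
  assumes grad: "\<And>x. GDERIV f x :> gf x" and \<beta>: "\<beta> > 0"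
    and coco: "\<And>a b. (a - b) \<bullet> (gf a - gf b) \<ge> \<beta> * (norm (gf a - gf b))\<^sup>2"
  shows "f x + gf x \<bullet> (y - x) + \<beta> / 2 * (norm (gf x - gf y))\<^sup>2 \<le> f y"
proof -
  define u where "u = gf y - gf x"
  define w where "w = y - \<beta> *\<^sub>R u"
  have lip: "(a - b) \<bullet> (gf a - gf b) \<le> (norm (a - b))\<^sup>2 / \<beta>" for a b
  proof -
    have "\<beta> * (norm (gf a - gf b))\<^sup>2 \<le> norm (a - b) * norm (gf a - gf b)"
      using coco[of a b] norm_cauchy_schwarz[of "a - b" "gf a - gf b"] by linarith
    then have n: "norm (gf a - gf b) \<le> norm (a - b) / \<beta>"
      using \<beta> by (cases "gf a = gf b") (auto simp: power2_eq_square field_simps)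
    have "(a - b) \<bullet> (gf a - gf b) \<le> norm (a - b) * norm (gf a - gf b)"
      by (rule norm_cauchy_schwarz)
    also have "\<dots> \<le> norm (a - b) * (norm (a - b) / \<beta>)" using n by (rule mult_left_mono) simp
    finally show ?thesis by (simp add: power2_eq_square)
  qed
  have "f x + gf x \<bullet> (w - x) \<le> f w"
    by (rule monotone_gradient_lower_bound[OF grad]) (rule order_trans[OF _ coco], use \<beta> in simp)
  also have "f w \<le> f y + gf y \<bullet> (w - y) + (norm (w - y))\<^sup>2 / \<beta> / 2"
    by (rule gradient_quadratic_upper_bound[OF grad lip]) (simp add: power_mult_distrib)
  also have "(norm (w - y))\<^sup>2 = \<beta>\<^sup>2 * (norm u)\<^sup>2" by (simp add: w_def power_mult_distrib)
  finally have "f x + gf x \<bullet> (w - x) \<le> f y + gf y \<bullet> (w - y) + \<beta> / 2 * (norm u)\<^sup>2"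
    using \<beta> by (simp add: power2_eq_square)
  moreover have "gf x \<bullet> (w - x) = gf x \<bullet> (y - x) - \<beta> * (gf x \<bullet> u)"
    "gf y \<bullet> (w - y) = - \<beta> * (gf y \<bullet> u)"
    by (simp_all add: w_def inner_diff_right)
  moreover have "\<beta> * (norm u)\<^sup>2 = \<beta> * (gf y \<bullet> u) - \<beta> * (gf x \<bullet> u)"
    by (simp add: power2_norm_eq_inner inner_diff_left u_def right_diff_distrib)
  moreover have "norm (gf x - gf y) = norm u" by (simp add: u_def norm_minus_commute)
  ultimately show ?thesis by (simp add: diff_divide_distrib)
qed

lemma monotone_gradient_convex_on:
  fixes f :: "'a::real_inner \<Rightarrow> real"
  assumes grad: "\<And>x. GDERIV f x :> gf x"
    and mono: "\<And>a b. 0 \<le> (a - b) \<bullet> (gf a - gf b)"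
  shows "convex_on UNIV f"
  unfolding convex_on_def
proof (intro conjI convex_UNIV ballI allI impI)
  fix x y :: 'a and u v :: real assume uv: "0 \<le> u" "0 \<le> v" "u + v = 1"
  define w where "w = u *\<^sub>R x + v *\<^sub>R y"
  note tangent = monotone_gradient_lower_bound[OF grad mono, of w]
  have "u * (f w + gf w \<bullet> (x - w)) + v * (f w + gf w \<bullet> (y - w)) \<le> u * f x + v * f y"
    using tangent[of x] tangent[of y] uv by (intro add_mono mult_left_mono)
  moreover have "u * (f w + gf w \<bullet> (x - w)) + v * (f w + gf w \<bullet> (y - w))
      = (u + v) * f w + gf w \<bullet> (w - (u + v) *\<^sub>R w)"
    by (simp add: w_def[of] inner_diff_right inner_add_right algebra_simps) 
  ultimately show "f (u *\<^sub>R x + v *\<^sub>R y) \<le> u * f x + v * f y" using uv by (simp add: w_def)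
qed

section \<open>The metric of the dual variable\<close>

text \<open>
  The last assumption is exactly what makes \<open>M\<close> positive semidefinite.
\<close>

locale pd3o_metric =
  fixes A :: "'a::{real_inner,complete_space} \<Rightarrow> 'b::{real_inner,complete_space}" and \<gamma> \<delta> :: real
  assumes A: "bounded_linear A" and pos: "\<gamma> > 0" "\<delta> > 0"
    and small: "\<gamma> * \<delta> * onorm (A \<circ> adjoint A) \<le> 1"
begin

lemma gram: "bounded_linear (A \<circ> adjoint A)"
  unfolding o_def by (rule bounded_linear_compose[OF A bounded_linear_adjoint[OF A]])

lemma M_linear: "linear (M_op \<gamma> \<delta> A)"
proof -
  have "linear (A \<circ> adjoint A)" by (rule bounded_linear.linear[OF gram])
  then show ?thesis
    unfolding M_op_def linear_iff by (simp add: algebra_simps)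
qed

lemma M_symmetric: "s \<bullet> M_op \<gamma> \<delta> A t = M_op \<gamma> \<delta> A s \<bullet> t"
proof -
  have "s \<bullet> A (adjoint A t) = A (adjoint A s) \<bullet> t"
    using inner_adjoint[OF A, of "adjoint A t" s] inner_adjoint[OF A, of "adjoint A s" t]
    by (simp add: inner_commute)
  then show ?thesis by (simp add: M_op_def inner_diff_left inner_diff_right)
qed

lemma M_nonneg: "0 \<le> s \<bullet> M_op \<gamma> \<delta> A s"
proof -
  have "\<gamma> * \<delta> * (s \<bullet> A (adjoint A s)) \<le> \<gamma> * \<delta> * (norm s * (onorm (A \<circ> adjoint A) * norm s))"
    using norm_cauchy_schwarz[of s "A (adjoint A s)"]
      mult_left_mono[OF onorm[OF gram, of s], of "norm s"] pos
    by (intro mult_left_mono) auto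
  also have "\<dots> = (\<gamma> * \<delta> * onorm (A \<circ> adjoint A)) * (norm s)\<^sup>2" by (simp add: power2_eq_square)
  also have "\<dots> \<le> 1 * (norm s)\<^sup>2" using small by (rule mult_right_mono) simp
  finally have "\<gamma> * \<delta> * (s \<bullet> A (adjoint A s)) \<le> s \<bullet> s" by (simp add: power2_norm_eq_inner)
  then show ?thesis
    using pos by (simp add: M_op_def inner_diff_right)
qed

lemma op_norm_M: "(op_norm (M_op \<gamma> \<delta> A) s)\<^sup>2 = s \<bullet> M_op \<gamma> \<delta> A s"
  unfolding op_norm_def using M_nonneg by (rule real_sqrt_pow2)

text \<open>
  The equation \<open>M v = u\<close> is the fixed point equation
  \<open>v = (\<delta> / \<gamma>) u + \<gamma> \<delta> A A\<^sup>T v\<close>, whose right-hand side is a contraction in \<open>v\<close>.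
\<close>

lemma M_surj:
  assumes "\<gamma> * \<delta> * onorm (A \<circ> adjoint A) < 1"
  shows "surj (M_op \<gamma> \<delta> A)"
  unfolding surj_def
proof
  fix u
  interpret G: bounded_linear "A \<circ> adjoint A" by (rule gram)
  define T where "T = (\<lambda>v. (\<delta> / \<gamma>) *\<^sub>R u + (\<gamma> * \<delta>) *\<^sub>R (A \<circ> adjoint A) v)"
  have "\<exists>!v. v \<in> UNIV \<and> T v = v"
  proof (rule Banach_fix)
    show "complete (UNIV :: 'b set)" by (rule complete_UNIV)
    show "0 \<le> \<gamma> * \<delta> * onorm (A \<circ> adjoint A)" using pos onorm_pos_le[OF gram] by simp
    show "dist (T x) (T y) \<le> \<gamma> * \<delta> * onorm (A \<circ> adjoint A) * dist x y" for x y
    proof -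
      have "T x - T y = (\<gamma> * \<delta>) *\<^sub>R (A \<circ> adjoint A) (x - y)"
        unfolding T_def G.diff by (simp add: scaleR_diff_right)
      then have "dist (T x) (T y) = \<gamma> * \<delta> * norm ((A \<circ> adjoint A) (x - y))"
        using pos by (simp add: dist_norm)
      also have "\<dots> \<le> \<gamma> * \<delta> * (onorm (A \<circ> adjoint A) * norm (x - y))"
        using onorm[OF gram] pos by (intro mult_left_mono) auto
      finally show ?thesis by (simp add: dist_norm)
    qed
  qed (use assms in auto)
  then obtain v where v: "T v = v" by blast
  have "v - (\<gamma> * \<delta>) *\<^sub>R A (adjoint A v) = (\<delta> / \<gamma>) *\<^sub>R u"
    using v unfolding T_def by (simp add: algebra_simps)
  then have "M_op \<gamma> \<delta> A v = u" using pos by (simp add: M_op_def)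
  then show "\<exists>v. u = M_op \<gamma> \<delta> A v" by blast
qed

text \<open>
  Turns cocoercivity in the norm of \<open>M\<^sup>-\<^sup>1\<close> into the upper bound on gradient increments that
  the descent lemma needs, stated in the norm of \<open>M\<close>.  With \<open>u = M v\<close> it is the Cauchy--Schwarz
  inequality for \<open>M\<close>, here in the form \<open>0 \<le> \<parallel>d - \<beta> v\<parallel>\<^sub>M\<^sup>2\<close>.
\<close>

lemma inner_gradient_increment_le:
  assumes strict: "\<gamma> * \<delta> * onorm (A \<circ> adjoint A) < 1" and \<beta>: "\<beta> > 0"
    and coco: "\<beta> * (op_norm (inv (M_op \<gamma> \<delta> A)) u)\<^sup>2 \<le> d \<bullet> u"
  shows "0 \<le> d \<bullet> u" "d \<bullet> u \<le> (d \<bullet> M_op \<gamma> \<delta> A d) / \<beta>"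
proof -
  let ?M = "M_op \<gamma> \<delta> A"
  define v where "v = inv ?M u"
  have u: "?M v = u" unfolding v_def by (rule surj_f_inv_f[OF M_surj[OF strict]])
  have "u \<bullet> v \<ge> 0" using M_nonneg[of v] by (simp add: u inner_commute)
  then have uv: "(op_norm (inv ?M) u)\<^sup>2 = v \<bullet> ?M v"
    by (simp add: op_norm_def u flip: v_def) (simp add: inner_commute)
  show "0 \<le> d \<bullet> u" by (rule order_trans[OF _ coco]) (use \<beta> in simp)
  have "0 \<le> (d - \<beta> *\<^sub>R v) \<bullet> ?M (d - \<beta> *\<^sub>R v)" by (rule M_nonneg)
  also have "\<dots> = d \<bullet> ?M d - 2 * \<beta> * (d \<bullet> u) + \<beta> * (\<beta> * (v \<bullet> ?M v))"
    using M_symmetric[of v d]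
    by (simp add: linear_diff[OF M_linear] linear_cmul[OF M_linear] inner_diff_left
        inner_diff_right u inner_commute algebra_simps)
  also have "\<dots> \<le> d \<bullet> ?M d - 2 * \<beta> * (d \<bullet> u) + \<beta> * (d \<bullet> u)"
    using coco \<beta> unfolding uv by (intro add_left_mono mult_left_mono) auto
  finally show "d \<bullet> u \<le> (d \<bullet> ?M d) / \<beta>" using \<beta> by (simp add: field_simps)
qed

end

section \<open>The gap of one iteration\<close>

text \<open>
  Here \<open>p\<close>, \<open>P\<close> stand for the gradients of \<open>f\<close> at \<open>x\<close>, \<open>X\<close> and \<open>v\<close>, \<open>V\<close> for
  \<open>A\<^sup>T s'\<close>, \<open>A\<^sup>T S\<close>.  The difference of the two sides is \<open>\<gamma>\<close> times the slack in the hypothesis plus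
  half of a squared norm.  The term \<open>\<gamma> / 2 * \<parallel>p - P\<parallel>\<^sup>2\<close> of the hypothesis, which
  cocoercivity supplies when \<open>\<gamma> \<le> \<beta>\<close>, completes that square.
\<close>

lemma primal_step_inequality:
  fixes x X z z' Z p P v V :: "'a::real_inner"
  assumes z': "z' = x - \<gamma> *\<^sub>R p - \<gamma> *\<^sub>R v" and Z: "Z = X - \<gamma> *\<^sub>R P - \<gamma> *\<^sub>R V"
    and \<gamma>: "\<gamma> > 0"
    and f: "fx + p \<bullet> (X - x) + \<gamma> / 2 * (norm (p - P))\<^sup>2 \<le> fX"
  shows "\<gamma> * (fx - fX) + (z - x) \<bullet> (x - X) + \<gamma> * (x \<bullet> V - X \<bullet> v) + \<gamma> * ((x - z + z') \<bullet> (v - V))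
    \<le> ((norm (Z - z))\<^sup>2 - (norm (Z - z'))\<^sup>2) / 2"
proof -
  have "((norm (Z - z))\<^sup>2 - (norm (Z - z'))\<^sup>2) / 2
      - (\<gamma> * (fx - fX) + (z - x) \<bullet> (x - X) + \<gamma> * (x \<bullet> V - X \<bullet> v) + \<gamma> * ((x - z + z') \<bullet> (v - V)))
    = \<gamma> * (fX - (fx + p \<bullet> (X - x) + \<gamma> / 2 * (norm (p - P))\<^sup>2))
      + (norm ((z' - z) + \<gamma> *\<^sub>R (p - P)))\<^sup>2 / 2"
    unfolding power2_norm_eq_inner z' Z
    by (simp add: inner_add_left inner_add_right inner_diff_left inner_diff_right inner_commute)
      (simp add: field_simps inner_commute)
  moreover have "0 \<le> \<gamma> * (fX - (fx + p \<bullet> (X - x) + \<gamma> / 2 * (norm (p - P))\<^sup>2))"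
    using \<gamma> f by simp
  ultimately show ?thesis by (smt (verit) zero_le_power2 divide_nonneg_pos)
qed

lemma symmetric_polarisation:
  fixes Q :: "'b::real_inner \<Rightarrow> 'b"
  assumes lin: "linear Q" and sym: "\<And>a b. a \<bullet> Q b = Q a \<bullet> b"
  shows "Q (s - s') \<bullet> (s' - S)
    = ((S - s) \<bullet> Q (S - s) - (s' - s) \<bullet> Q (s' - s) - (S - s') \<bullet> Q (S - s')) / 2"
proof -
  have "a \<bullet> Q b = b \<bullet> Q a" for a b using sym[of a b] by (simp add: inner_commute)
  from this[of S s] this[of S s'] this[of s s'] show ?thesis
    by (simp add: linear_diff[OF lin] inner_diff_left inner_diff_right inner_commute[of "Q _"])
qed

section \<open>The ergodic estimate\<close>

lemma convex_on_average:
  assumes "convex_on D \<phi>" "\<And>i. y i \<in> D"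
  shows "(1 / real (k + 1)) *\<^sub>R (\<Sum>i=0..k. y i) \<in> D"
    and "real (k + 1) * \<phi> ((1 / real (k + 1)) *\<^sub>R (\<Sum>i=0..k. y i)) \<le> (\<Sum>i=0..k. \<phi> (y i))"
proof -
  have eq: "(1 / real (k + 1)) *\<^sub>R (\<Sum>i=0..k. y i) = (\<Sum>i=0..k. (1 / real (k + 1)) *\<^sub>R y i)"
    by (simp add: scaleR_sum_right)
  show "(1 / real (k + 1)) *\<^sub>R (\<Sum>i=0..k. y i) \<in> D"
    unfolding eq using assms by (intro convex_sum convex_on_imp_convex[OF assms(1)]) auto
  have "\<phi> (\<Sum>i=0..k. (1 / real (k + 1)) *\<^sub>R y i) \<le> (\<Sum>i=0..k. (1 / real (k + 1)) * \<phi> (y i))"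
    using assms by (intro convex_on_sum) auto
  also have "\<dots> = (1 / real (k + 1)) * (\<Sum>i=0..k. \<phi> (y i))" by (simp add: sum_distrib_left)
  finally show "real (k + 1) * \<phi> ((1 / real (k + 1)) *\<^sub>R (\<Sum>i=0..k. y i)) \<le> (\<Sum>i=0..k. \<phi> (y i))"
    unfolding eq by (simp add: field_simps)
qed

text \<open>
  The gap of one iteration is bounded by the decrease of the squared distance to \<open>(Z, S)\<close>,
  so that the bounds telescope over the iterations.  Here \<open>p\<close>, \<open>P\<close>, \<open>c\<close> are the gradients of \<open>f\<close> at \<open>x\<close>, \<open>X\<close> and of
  \<open>l\<^sup>*\<close> at \<open>s\<close>; the numbers are the values of the functions at the points in
  question.  Inserting the definition of \<open>z'\<close> into the dual prox step gives
  \<open>(w - s') / \<delta> = M (s - s') / \<gamma> - c + A (x - z + z')\<close>.  Its first summand, paired with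
  \<open>s' - S\<close>, telescopes by polarisation and leaves \<open>- \<parallel>s' - s\<parallel>\<^sub>M\<^sup>2 / (2 \<gamma>)\<close>, which pays for the quadratic term in
  \<open>l_upper\<close>; the last summand is absorbed by the primal inequality.
\<close>

lemma (in pd3o_metric) pd3o_step_gap:
  fixes Gx GX Hs' HS fx fX ls ls' lS :: real
  assumes f: "fx + p \<bullet> (X - x) + \<gamma> / 2 * (norm (p - P))\<^sup>2 \<le> fX"
    and g: "Gx + (z - x) \<bullet> (X - x) / \<gamma> \<le> GX"
    and h: "Hs' + (w - s') \<bullet> (S - s') / \<delta> \<le> HS"
    and w: "w = (s - (\<gamma> * \<delta>) *\<^sub>R A (adjoint A s)) - \<delta> *\<^sub>R c + \<delta> *\<^sub>R A (2 *\<^sub>R x - z - \<gamma> *\<^sub>R p)"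
    and l_upper: "ls' \<le> ls + c \<bullet> (s' - s) + ((s' - s) \<bullet> M_op \<gamma> \<delta> A (s' - s)) / (2 * \<gamma>)"
    and l_lower: "ls + c \<bullet> (S - s) \<le> lS"
    and z': "z' = x - \<gamma> *\<^sub>R p - \<gamma> *\<^sub>R adjoint A s'"
    and Z: "Z = X - \<gamma> *\<^sub>R P - \<gamma> *\<^sub>R adjoint A S"
  shows "(fx + Gx + A x \<bullet> S - HS - lS) - (fX + GX + A X \<bullet> s' - Hs' - ls')
    \<le> (((norm (Z - z))\<^sup>2 + (S - s) \<bullet> M_op \<gamma> \<delta> A (S - s))
        - ((norm (Z - z'))\<^sup>2 + (S - s') \<bullet> M_op \<gamma> \<delta> A (S - s'))) / (2 * \<gamma>)"
proof -
  interpret A: bounded_linear A by (rule A)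
  interpret B: bounded_linear "adjoint A" by (rule bounded_linear_adjoint[OF A])
  let ?M = "M_op \<gamma> \<delta> A" and ?y = "x - z + z'"
  let ?v = "adjoint A s'" and ?V = "adjoint A S"
  have "\<delta> *\<^sub>R ((1 / \<gamma>) *\<^sub>R ?M (s - s'))
      = s - s' - (\<gamma> * \<delta>) *\<^sub>R A (adjoint A s) + (\<gamma> * \<delta>) *\<^sub>R A ?v"
    using pos by (simp add: M_op_def A.diff B.diff algebra_simps)
  moreover have "\<delta> *\<^sub>R A ?y = \<delta> *\<^sub>R A (2 *\<^sub>R x - z - \<gamma> *\<^sub>R p) - (\<gamma> * \<delta>) *\<^sub>R A ?v"
    unfolding z' by (simp add: A.diff A.add A.scaleR algebra_simps scaleR_2)
  ultimately have "w - s' = \<delta> *\<^sub>R ((1 / \<gamma>) *\<^sub>R ?M (s - s') - c + A ?y)"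
    unfolding w scaleR_add_right scaleR_diff_right by simp
  then have "(w - s') \<bullet> (S - s') / \<delta> = ((1 / \<gamma>) *\<^sub>R ?M (s - s') - c + A ?y) \<bullet> (S - s')"
    using pos by simp
  also have "\<dots> = (?M (s - s') \<bullet> (S - s')) / \<gamma> - c \<bullet> (S - s') + ?y \<bullet> (?V - ?v)"
    by (simp add: inner_add_left inner_diff_left inner_adjoint[OF A] B.diff)
  finally have inner_w: "(w - s') \<bullet> (S - s') / \<delta>
      = (?M (s - s') \<bullet> (S - s')) / \<gamma> - c \<bullet> (S - s') + ?y \<bullet> (?V - ?v)" .
  have h': "\<gamma> * Hs' + ?M (s - s') \<bullet> (S - s') - \<gamma> * (c \<bullet> (S - s')) + \<gamma> * (?y \<bullet> (?V - ?v))
      \<le> \<gamma> * HS"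
    using mult_left_mono[OF h[unfolded inner_w], of \<gamma>] pos
    by (simp add: distrib_left right_diff_distrib)
  have g': "\<gamma> * Gx + (z - x) \<bullet> (X - x) \<le> \<gamma> * GX"
    using mult_left_mono[OF g, of \<gamma>] pos by (simp add: distrib_left)
  have "\<gamma> * ls' \<le> \<gamma> * (ls + c \<bullet> (s' - s) + ((s' - s) \<bullet> ?M (s' - s)) / (2 * \<gamma>))"
    using l_upper pos by (intro mult_left_mono) auto
  then have lu: "\<gamma> * ls' \<le> \<gamma> * ls + \<gamma> * (c \<bullet> (s' - s)) + ((s' - s) \<bullet> ?M (s' - s)) / 2"
    using pos by (simp add: distrib_left)
  have ll: "\<gamma> * ls + \<gamma> * (c \<bullet> (S - s)) \<le> \<gamma> * lS"
    using mult_left_mono[OF l_lower, of \<gamma>] pos by (simp add: algebra_simps)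
  have c: "\<gamma> * (c \<bullet> (S - s')) = \<gamma> * (c \<bullet> (S - s)) - \<gamma> * (c \<bullet> (s' - s))"
    by (simp add: inner_diff_right algebra_simps)
  have flip: "?M (s - s') \<bullet> (S - s') = - (?M (s - s') \<bullet> (s' - S))"
    "\<gamma> * (?y \<bullet> (?V - ?v)) = - (\<gamma> * (?y \<bullet> (?v - ?V)))" "(z - x) \<bullet> (X - x) = - ((z - x) \<bullet> (x - X))"
    by (simp_all add: inner_diff_right algebra_simps)
  have AX: "\<gamma> * (x \<bullet> ?V - X \<bullet> ?v) = \<gamma> * (A x \<bullet> S) - \<gamma> * (A X \<bullet> s')"
    by (simp add: inner_adjoint[OF A] right_diff_distrib)
  have "\<gamma> * ((fx + Gx + A x \<bullet> S - HS - lS) - (fX + GX + A X \<bullet> s' - Hs' - ls'))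
    = \<gamma> * (fx - fX) + \<gamma> * Gx + \<gamma> * (A x \<bullet> S) - \<gamma> * HS - \<gamma> * lS - \<gamma> * GX
        - \<gamma> * (A X \<bullet> s') + \<gamma> * Hs' + \<gamma> * ls'"
    by (simp add: algebra_simps)
  also have "\<dots> \<le> (((norm (Z - z))\<^sup>2 + (S - s) \<bullet> ?M (S - s))
        - ((norm (Z - z'))\<^sup>2 + (S - s') \<bullet> ?M (S - s'))) / 2"
    using primal_step_inequality[OF z' Z pos(1) f, of z] g' h' lu ll c flip AX
      symmetric_polarisation[OF M_linear M_symmetric, of s s' S]
    unfolding diff_divide_distrib add_divide_distrib by linarith
  finally show ?thesis using pos by (simp add: field_simps)
qed

text \<open>
  At averages of iterates \<open>g\<close> and \<open>h\<^sup>*\<close> are finite, so the gap is either \<open>- \<infinity>\<close>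
  or a difference of real numbers.  The indeterminate
  form \<open>\<infinity> - \<infinity>\<close> cannot arise, as each of the two Lagrangians has at most one infinite term.
\<close>

lemma lagrangian_gap_ereal:
  fixes g :: "'a::real_inner \<Rightarrow> ereal" and hc :: "'b::real_inner \<Rightarrow> ereal"
  assumes "proper_fun g" "proper_fun hc" "g x' \<noteq> \<infinity>" "hc s' \<noteq> \<infinity>"
  shows "g x = \<infinity> \<or> hc s = \<infinity> \<Longrightarrow>
      lagrangian A f g hc (\<lambda>s. ereal (lc s)) x' s - lagrangian A f g hc (\<lambda>s. ereal (lc s)) x s' = -\<infinity>"
    and "g x \<noteq> \<infinity> \<Longrightarrow> hc s \<noteq> \<infinity> \<Longrightarrow>
      lagrangian A f g hc (\<lambda>s. ereal (lc s)) x' s - lagrangian A f g hc (\<lambda>s. ereal (lc s)) x s'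
      = ereal ((f x' + real_of_ereal (g x') + A x' \<bullet> s - real_of_ereal (hc s) - lc s)
          - (f x + real_of_ereal (g x) + A x \<bullet> s' - real_of_ereal (hc s') - lc s'))"
  using assms unfolding lagrangian_def proper_fun_def
  by (cases "g x'"; cases "hc s'"; cases "g x"; cases "hc s"; fastforce)+

theorem theorem2:
  fixes A :: "'a::{real_inner,complete_space} \<Rightarrow> 'b::{real_inner,complete_space}"
    and f :: "'a \<Rightarrow> real" and g :: "'a \<Rightarrow> ereal"
    and h l :: "'b \<Rightarrow> ereal" and lc :: "'b \<Rightarrow> real"
    and gf :: "'a \<Rightarrow> 'a" and gl :: "'b \<Rightarrow> 'b"
    and \<gamma> \<delta> \<beta> :: real
    and xs zs :: "nat \<Rightarrow> 'a" and ss :: "nat \<Rightarrow> 'b"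
    and xbar :: "nat \<Rightarrow> 'a" and sbar :: "nat \<Rightarrow> 'b"
    and k :: nat and x z :: 'a and s :: 'b
  assumes "bounded_linear A"
    and "proper_lsc_convex (\<lambda>x. ereal (f x))"
    and "proper_lsc_convex g"
    and "proper_lsc_convex h"
    and "proper_lsc_convex l"
    and "\<And>s. conjugate l s = ereal (lc s)"
    and "\<And>x. GDERIV f x :> gf x"
    and "\<And>s. GDERIV lc s :> gl s"
    and "\<exists>L. L-lipschitz_on UNIV gf"
    and "\<exists>L. L-lipschitz_on UNIV gl"
    and "\<gamma> > 0" and "\<delta> > 0" and "\<gamma> \<le> \<beta>"
    and "standing_assumption \<beta> \<gamma> \<delta> A gf gl"
    and "pd3o \<gamma> \<delta> A gf g (conjugate h) gl xs zs ss"
    and "\<And>k. xbar k = (1 / real (k + 1)) *\<^sub>R (\<Sum>i=0..k. xs i)"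
    and "\<And>k. sbar (k + 1) = (1 / real (k + 1)) *\<^sub>R (\<Sum>i=0..k. ss (i + 1))"
    and "z = x - \<gamma> *\<^sub>R gf x - \<gamma> *\<^sub>R adjoint A s"
  shows "lagrangian A f g (conjugate h) (conjugate l) (xbar k) s
           - lagrangian A f g (conjugate h) (conjugate l) x (sbar (k + 1))
         \<le> ereal (1 / (2 * real (k + 1) * \<gamma>)
                   * (pair_norm (M_op \<gamma> \<delta> A) ((z, s) - (zs 0, ss 0)))\<^sup>2)"
proof -
  define hc where "hc = conjugate h"
  define G where "G = (\<lambda>x. real_of_ereal (g x))"
  define H where "H = (\<lambda>s. real_of_ereal (hc s))"
  define q where "q = (\<lambda>u. u \<bullet> M_op \<gamma> \<delta> A u)"
  note g = \<open>proper_lsc_convex g\<close> and gradf = assms(7) and gradl = assms(8)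
    and \<gamma> = \<open>\<gamma> > 0\<close> and \<delta> = \<open>\<delta> > 0\<close>
  have hc: "proper_lsc_convex hc"
    unfolding hc_def by (rule conjugate_proper_lsc_convex[OF \<open>proper_lsc_convex h\<close>])
  have lc: "conjugate l = (\<lambda>s. ereal (lc s))" using assms(6) by auto
  have Pg: "proper_fun g" and Ph: "proper_fun hc"
    using g hc by (simp_all add: proper_lsc_convex_def)
  have convG: "convex_on {x. g x \<noteq> \<infinity>} G" and convH: "convex_on {s. hc s \<noteq> \<infinity>} H"
    using g hc unfolding G_def H_def proper_lsc_convex_def
    by (auto intro: convex_fun_convex_on_domain)

  have \<beta>: "\<beta> > 0"
    and cocof: "\<And>a b. (a - b) \<bullet> (gf a - gf b) \<ge> \<beta> * (norm (gf a - gf b))\<^sup>2"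
    using assms(14) by (auto simp: standing_assumption_def)
  interpret pd3o_metric A \<gamma> \<delta>
    by (rule pd3o_metric.intro)
      (use assms(1,11,12,14) in \<open>auto simp: standing_assumption_def split: if_splits\<close>)
  have qpos: "0 \<le> q u" for u unfolding q_def by (rule M_nonneg)
  (* Weakening \<beta> to \<gamma> lets the constant and the nonconstant gradient share one bound. *)
  have gl_bounds: "0 \<le> (a - b) \<bullet> (gl a - gl b) \<and> (a - b) \<bullet> (gl a - gl b) \<le> q (a - b) / \<gamma>" for a b
  proof (cases "\<exists>c. \<forall>s. gl s = c")
    case True
    then have "gl a = gl b" by metis
    then show ?thesis using qpos \<gamma> by simp
  next
    case False
    then have "\<gamma> * \<delta> * onorm (A \<circ> adjoint A) < 1"
      "\<beta> * (op_norm (inv (M_op \<gamma> \<delta> A)) (gl a - gl b))\<^sup>2 \<le> (a - b) \<bullet> (gl a - gl b)"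
      using assms(14) unfolding standing_assumption_def by auto
    from inner_gradient_increment_le[OF this(1) \<beta> this(2)]
    have "0 \<le> (a - b) \<bullet> (gl a - gl b)" "(a - b) \<bullet> (gl a - gl b) \<le> q (a - b) / \<beta>"
      by (simp_all add: q_def)
    moreover have "q (a - b) / \<beta> \<le> q (a - b) / \<gamma>"
      using qpos \<gamma> \<open>\<gamma> \<le> \<beta>\<close> by (intro divide_left_mono) auto
    ultimately show ?thesis by linarith
  qed
  have monof: "0 \<le> (a - b) \<bullet> (gf a - gf b)" for a b
    by (rule order_trans[OF _ cocof]) (use \<beta> in simp)
  have convf: "convex_on UNIV f" by (rule monotone_gradient_convex_on[OF gradf monof])
  have convl: "convex_on UNIV lc" by (rule monotone_gradient_convex_on[OF gradl]) (simp add: gl_bounds)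
  have f_lower: "f a + gf a \<bullet> (b - a) + \<gamma> / 2 * (norm (gf a - gf b))\<^sup>2 \<le> f b" for a b
  proof -
    have "\<gamma> / 2 * (norm (gf a - gf b))\<^sup>2 \<le> \<beta> / 2 * (norm (gf a - gf b))\<^sup>2"
      using \<open>\<gamma> \<le> \<beta>\<close> by (intro mult_right_mono) auto
    then show ?thesis using cocoercive_gradient_lower_bound[OF gradf \<beta> cocof, of a b] by linarith
  qed
  have l_lower: "lc a + gl a \<bullet> (b - a) \<le> lc b" for a b
    by (rule monotone_gradient_lower_bound[OF gradl]) (simp add: gl_bounds)
  have l_upper: "lc b \<le> lc a + gl a \<bullet> (b - a) + q (b - a) / (2 * \<gamma>)" for a b
    using gradient_quadratic_upper_bound[of lc gl "\<lambda>u. q u / \<gamma>" b a] gradl gl_bounds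
    by (simp add: q_def linear_cmul[OF M_linear] power2_eq_square mult.commute)

  have x_prox: "xs i = prox \<gamma> g (zs i)"
    and s_prox: "ss (Suc i) = prox \<delta> hc
        ((ss i - (\<gamma> * \<delta>) *\<^sub>R A (adjoint A (ss i))) - \<delta> *\<^sub>R gl (ss i)
          + \<delta> *\<^sub>R A (2 *\<^sub>R xs i - zs i - \<gamma> *\<^sub>R gf (xs i)))"
    and z_step: "zs (Suc i) = xs i - \<gamma> *\<^sub>R gf (xs i) - \<gamma> *\<^sub>R adjoint A (ss (Suc i))" for i
    using assms(15) unfolding pd3o_def hc_def by blast+
  have xs_dom: "g (xs i) \<noteq> \<infinity>" for i
    by (rule prox_variational_inequality(1)[OF g \<gamma> x_prox])
  have ss_dom: "hc (ss (Suc i)) \<noteq> \<infinity>" for i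
    by (rule prox_variational_inequality(1)[OF hc \<delta> s_prox])

  have xbar_dom: "g (xbar k) \<noteq> \<infinity>"
    using convex_on_average(1)[OF convG, of xs k] xs_dom by (simp add: assms(16))
  have sbar_dom: "hc (sbar (k + 1)) \<noteq> \<infinity>"
    using convex_on_average(1)[OF convH, of "\<lambda>i. ss (i + 1)" k] ss_dom by (simp add: assms(17)[simplified])
  note gap = lagrangian_gap_ereal[OF Pg Ph xbar_dom sbar_dom, of x s A f lc, folded G_def H_def]
  show ?thesis
  proof (cases "g x = \<infinity> \<or> hc s = \<infinity>")
    case True
    show ?thesis using gap(1)[OF True] unfolding lc hc_def[symmetric] by simp
  next
    case False
    define \<Delta> where "\<Delta> = (\<lambda>i. (norm (z - zs i))\<^sup>2 + q (s - ss i))"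
    define L where "L = (\<lambda>a b. f a + G a + A a \<bullet> b - H b - lc b)"
    have step: "L (xs i) s - L x (ss (Suc i)) \<le> (\<Delta> i - \<Delta> (Suc i)) / (2 * \<gamma>)" for i
      unfolding L_def \<Delta>_def q_def
    proof (rule pd3o_step_gap[OF f_lower _ _ refl _ l_lower z_step \<open>z = _\<close>])
      show "G (xs i) + (zs i - xs i) \<bullet> (x - xs i) / \<gamma> \<le> G x"
        unfolding G_def using False by (intro prox_variational_inequality(2)[OF g \<gamma> x_prox]) simp
      show "H (ss (Suc i)) + ((ss i - (\<gamma> * \<delta>) *\<^sub>R A (adjoint A (ss i))) - \<delta> *\<^sub>R gl (ss i)
          + \<delta> *\<^sub>R A (2 *\<^sub>R xs i - zs i - \<gamma> *\<^sub>R gf (xs i)) - ss (Suc i)) \<bullet> (s - ss (Suc i)) / \<delta> \<le> H s"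
        unfolding H_def using False by (intro prox_variational_inequality(2)[OF hc \<delta> s_prox]) simp
      show "lc (ss (Suc i)) \<le> lc (ss i) + gl (ss i) \<bullet> (ss (Suc i) - ss i)
          + (ss (Suc i) - ss i) \<bullet> M_op \<gamma> \<delta> A (ss (Suc i) - ss i) / (2 * \<gamma>)"
        using l_upper unfolding q_def .
    qed
    define n where "n = real (k + 1)"
    have n: "n > 0" by (simp add: n_def)
    have "n * (L (xbar k) s - L x (sbar (k + 1))) \<le> (\<Sum>i=0..k. L (xs i) s - L x (ss (Suc i)))"
    proof -
      interpret A: bounded_linear A by fact
      have "n * f (xbar k) \<le> (\<Sum>i=0..k. f (xs i))" "n * G (xbar k) \<le> (\<Sum>i=0..k. G (xs i))"
        "n * H (sbar (k + 1)) \<le> (\<Sum>i=0..k. H (ss (i + 1)))"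
        "n * lc (sbar (k + 1)) \<le> (\<Sum>i=0..k. lc (ss (i + 1)))"
        unfolding n_def assms(16) assms(17)
        by (intro convex_on_average(2)[OF convf] convex_on_average(2)[OF convG]
            convex_on_average(2)[OF convH] convex_on_average(2)[OF convl];
            simp add: xs_dom ss_dom)+
      moreover have "n * (A (xbar k) \<bullet> s) = (\<Sum>i=0..k. A (xs i) \<bullet> s)"
        using n unfolding n_def assms(16) A.scaleR A.sum by (simp add: inner_sum_left)
      moreover have "n * (A x \<bullet> sbar (k + 1)) = (\<Sum>i=0..k. A x \<bullet> ss (i + 1))"
        using n unfolding n_def assms(17) by (simp add: inner_sum_right)
      moreover have "1 + real k = n" by (simp add: n_def)
      ultimately show ?thesis
        unfolding L_def by (simp add: sum.distrib sum_subtractf right_diff_distrib distrib_left)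
    qed
    also have "\<dots> \<le> (\<Sum>i=0..k. (\<Delta> i - \<Delta> (Suc i)) / (2 * \<gamma>))" by (rule sum_mono[OF step])
    also have "\<dots> = (\<Delta> 0 - \<Delta> (Suc k)) / (2 * \<gamma>)"
      using sum_telescope[of \<Delta> k] by (simp add: sum_divide_distrib[symmetric] atMost_atLeast0)
    also have "\<dots> \<le> \<Delta> 0 / (2 * \<gamma>)"
    proof (rule divide_right_mono)
      have "0 \<le> \<Delta> (Suc k)" using qpos by (simp add: \<Delta>_def)
      then show "\<Delta> 0 - \<Delta> (Suc k) \<le> \<Delta> 0" by simp
    qed (use \<gamma> in simp)
    finally have "L (xbar k) s - L x (sbar (k + 1)) \<le> 1 / (2 * n * \<gamma>) * \<Delta> 0"
      using n \<gamma> by (simp add: field_simps)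
    moreover have "(pair_norm (M_op \<gamma> \<delta> A) ((z, s) - (zs 0, ss 0)))\<^sup>2 = \<Delta> 0"
      using qpos[of "s - ss 0"] by (simp add: pair_norm_def op_norm_M \<Delta>_def q_def)
    ultimately show ?thesis
      using gap(2) False unfolding lc hc_def[symmetric] L_def n_def G_def H_def by simp
  qed
qed

end
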